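(* Let $p$ be a prime integer and let $\mathcal{P}\subset\mathbb{R}^d$ be a lattice polytope of dimension $d$ whose normalized volume equals $p$. Suppose that $\mathcal{P}$ is not an empty simplex. Then $\mathcal{P}$ is spanning.
   Context: A lattice polytope is a convex polytope with all vertices in $\mathbb{Z}^d$. The normalized volume of a $d$-dimensional lattice polytope is $d!$ times its Euclidean volume. A lattice simplex is empty if its only lattice points are its vertices. The index of $\mathcal{P}$ is the index in $\mathbb{Z}^d$ of the affine sublattice generated by $\mathcal{P}\cap\mathbb{Z}^d$; $\mathcal{P}$ is spanning if its index equals $1$ (equivalently, every point of $\mathbb{Z}^{d+1}$ is an integer linear combination of the points of $(\mathcal{P}\cap\mathbb{Z}^d)\times\{1\}$). *)

theory Defs
  imports
    "HOL-Analysis.Analysis"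
    "HOL-Computational_Algebra.Group_Closure"
    "HOL-Computational_Algebra.Primes"
begin

definition int_lattice :: "(real ^ 'n) set" where
  "int_lattice = {x. \<forall>i. x $ i \<in> \<int>}"

definition lattice_polytope :: "(real ^ 'n) set \<Rightarrow> bool" where
  "lattice_polytope P \<longleftrightarrow> polytope P \<and> (\<forall>v. v extreme_point_of P \<longrightarrow> v \<in> int_lattice)"

text \<open>Normalized with respect to the ambient dimension, so meaningful for full-dimensional sets.\<close>

definition normalized_volume :: "(real ^ 'n) set \<Rightarrow> real" where
  "normalized_volume P = fact CARD('n) * measure lborel P"

definition empty_simplex :: "(real ^ 'n) set \<Rightarrow> bool" where
  "empty_simplex P \<longleftrightarrow>
     (\<exists>k. k simplex P) \<and> lattice_polytope P \<and> P \<inter> int_lattice = {v. v extreme_point_of P}"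

text \<open>The affine sublattice generated by \<open>S\<close>: all integer affine combinations of points of \<open>S\<close>.\<close>

definition affine_lattice :: "(real ^ 'n) set \<Rightarrow> (real ^ 'n) set" where
  "affine_lattice S =
     {\<Sum>x\<in>F. of_int (c x) *\<^sub>R x | F c. finite F \<and> F \<subseteq> S \<and> (\<Sum>x\<in>F. c x) = (1 :: int)}"

text \<open>
  The group of translations of an affine lattice \<open>L\<close>. If \<open>L\<close> is nonempty, its differences already
  form a group; the closure only serves to give \<open>{0}\<close> for \<open>L = {}\<close>.
\<close>

definition direction_lattice :: "(real ^ 'n) set \<Rightarrow> (real ^ 'n) set" where
  "direction_lattice L = group_closure {x - y | x y. x \<in> L \<and> y \<in> L}"

text \<open>
  The index of an affine sublattice \<open>L\<close> of the integer lattice is the index of its group of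
  translations, i.e. the number of cosets. Since \<^const>\<open>card\<close> is \<open>0\<close> on infinite sets, an infinite
  index is represented by \<open>0\<close>.
\<close>

definition affine_lattice_index :: "(real ^ 'n) set \<Rightarrow> nat" where
  "affine_lattice_index L =
     card (int_lattice //
       {(x, y). x \<in> int_lattice \<and> y \<in> int_lattice \<and> x - y \<in> direction_lattice L})"

definition polytope_index :: "(real ^ 'n) set \<Rightarrow> nat" where
  "polytope_index P = affine_lattice_index (affine_lattice (P \<inter> int_lattice))"

definition spanning :: "(real ^ 'n) set \<Rightarrow> bool" where
  "spanning P \<longleftrightarrow> polytope_index P = 1"

end

theory Submission
  imports Defs
begin

text \<open>
  Let \<open>\<Lambda>\<close> be the group generated by the differences of lattice points of \<open>P\<close>. By Cramer's rule, the
  normalized volume \<open>m\<close> of any full-dimensional simplex with vertices among these points satisfies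
  \<open>m \<int>\<^sup>d \<subseteq> \<Lambda>\<close>. A triangulation of \<open>P\<close> without new vertices writes \<open>p\<close> as a sum of such numbers, so
  \<open>p \<int>\<^sup>d \<subseteq> \<Lambda>\<close> as well; if some \<open>m\<close> is prime to \<open>p\<close>, Bezout gives \<open>\<int>\<^sup>d \<subseteq> \<Lambda>\<close>. Otherwise \<open>p\<close> divides
  every \<open>m\<close>, so a single simplex already has the volume of \<open>P\<close> and hence equals \<open>P\<close>. A lattice point
  of \<open>P\<close> other than a vertex could replace some vertex and give a simplex of normalized volume
  strictly between \<open>0\<close> and \<open>p\<close>; so \<open>P\<close> is an empty simplex.
\<close>

subsection \<open>Triangulating a polytope\<close>

text \<open>Take a face of least dimension among those containing \<open>x\<close>. If
  \<open>x\<close> were on its relative frontier, it would lie in a facet of that face, which is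
  again a face of \<open>P\<close> but of smaller dimension.\<close>

lemma face_rel_interior_exists:
  fixes P :: "'a::euclidean_space set"
  assumes "polytope P" "x \<in> P"
  obtains G where "G face_of P" "x \<in> rel_interior G"
proof -
  define \<G> where "\<G> = {G. G face_of P \<and> x \<in> G}"
  have "P \<in> \<G>"
    using assms by (simp add: \<G>_def face_of_refl polytope_imp_convex)
  \<comment> \<open>Dimensions start at -1; the shift by 1 lets the least-number principle for
    naturals apply without \<open>nat\<close> truncating anything.\<close>
  then obtain G where G: "G \<in> \<G>" and min: "\<And>H. H \<in> \<G> \<Longrightarrow> nat (aff_dim G + 1) \<le> nat (aff_dim H + 1)"
    using exists_least_iff[of "\<lambda>n. \<exists>G\<in>\<G>. n = nat (aff_dim G + 1)"] by (metis linorder_not_less)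
  have "polytope G" "G face_of P" "x \<in> G"
    using G assms face_of_polytope_polytope by (auto simp: \<G>_def)
  have "x \<in> rel_interior G"
  proof (rule ccontr)
    assume "x \<notin> rel_interior G"
    then have "x \<in> rel_frontier G"
      using \<open>x \<in> G\<close> closure_subset by (auto simp: rel_frontier_def)
    then obtain H where H: "H facet_of G" "x \<in> H"
      using rel_frontier_of_polyhedron[OF polytope_imp_polyhedron[OF \<open>polytope G\<close>]] by auto
    then have "H \<in> \<G>"
      using \<open>G face_of P\<close> facet_of_imp_face_of face_of_trans unfolding \<G>_def by blast
    moreover have "aff_dim H < aff_dim G"
      using H by (simp add: facet_of_def)
    moreover have "aff_dim H \<ge> -1"
      by (rule aff_dim_geq)
    ultimately show False
      using min[of H] by linarith
  qed
  with that \<open>G face_of P\<close> show thesis by blast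
qed

text \<open>A nonempty proper face of a polyhedron is the intersection of the facets containing it,
  so a point outside the face is missed by one of them.\<close>

lemma facet_avoiding:
  assumes "polyhedron P" "H face_of P" "H \<noteq> {}" "v \<in> P" "v \<notin> H"
  obtains F where "F facet_of P" "H \<subseteq> F" "v \<notin> F"
proof -
  have "H \<noteq> P" using assms by auto
  with assms have "H = \<Inter>{F. F facet_of P \<and> H \<subseteq> F}"
    by (intro face_of_polyhedron) auto
  with assms that show thesis by blast
qed

text \<open>The pyramids with apex \<open>v\<close> over the facets avoiding \<open>v\<close> cover
  \<open>P\<close>. The point \<open>y\<close> is where the ray from \<open>v\<close> through
  \<open>x\<close> leaves the face \<open>G\<close> that has \<open>x\<close> in its relative
  interior. The facet of \<open>G\<close> hit there avoids \<open>v\<close>, as otherwise it would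
  contain \<open>x\<close> by convexity.\<close>

lemma polytope_pyramid_cover:
  fixes P :: "'a::euclidean_space set"
  assumes "polytope P" "v \<in> P" "x \<in> P" "x \<noteq> v"
  obtains F y where "F facet_of P" "v \<notin> F" "y \<in> F" "x \<in> closed_segment v y"
proof -
  obtain G where G: "G face_of P" "x \<in> rel_interior G"
    using face_rel_interior_exists assms by blast
  have "polytope G"
    using G assms face_of_polytope_polytope by blast
  have "\<exists>H y. H face_of P \<and> v \<notin> H \<and> y \<in> H \<and> x \<in> closed_segment v y"
  proof (cases "v \<in> G")
    case False
    \<comment> \<open>Here \<open>y = x\<close> and \<open>H = G\<close> already serve.\<close>
    then show ?thesis
      using G rel_interior_subset by force
  next
    case True
    have "x \<in> G" using G rel_interior_subset by blast
    \<comment> \<open>The point \<open>2 x - v\<close> is an affine combination of points of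
      \<open>G\<close>; this shows that the ray runs inside the affine hull of \<open>G\<close>, so
      it must meet the relative frontier of the bounded set \<open>G\<close>.\<close>
    have "x + 1 *\<^sub>R (x - v) \<in> affine hull G"
      using mem_affine[OF affine_affine_hull[of G] hull_inc[of x G] hull_inc[of v G], of 2 "-1"]
        True \<open>x \<in> G\<close> by (simp add: algebra_simps scaleR_2)
    then obtain d where d: "0 < d" and y: "x + d *\<^sub>R (x - v) \<in> rel_frontier G"
      using ray_to_rel_frontier[of G x "x - v"] G(2) \<open>polytope G\<close> assms
      by (auto simp: polytope_imp_bounded)
    define y where "y = x + d *\<^sub>R (x - v)"
    obtain H where H: "H facet_of G" "y \<in> H"
      using y rel_frontier_of_polyhedron[OF polytope_imp_polyhedron[OF \<open>polytope G\<close>]]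
      by (auto simp: y_def)
    have "x = (1 - 1/(1+d)) *\<^sub>R v + (1/(1+d)) *\<^sub>R y"
    proof -
      have "y - v = (1 + d) *\<^sub>R (x - v)"
        by (simp add: y_def algebra_simps)
      then have "(1/(1+d)) *\<^sub>R (y - v) = x - v"
        using d by simp
      then show ?thesis
        by (simp add: algebra_simps)
    qed
    then have x: "x \<in> closed_segment v y"
      using d unfolding in_segment by (intro exI[of _ "1/(1+d)"]) auto
    have "v \<notin> H"
    proof
      assume "v \<in> H"
      moreover have "convex H"
        using H face_of_imp_convex facet_of_imp_face_of by blast
      ultimately have "x \<in> H"
        using x H(2) closed_segment_subset by blast
      moreover have "H face_of G" "H \<noteq> G"
        using H by (auto simp: facet_of_def)
      ultimately show False
        using face_of_disjoint_rel_interior G(2) by blast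
    qed
    moreover have "H face_of P"
      using H G facet_of_imp_face_of face_of_trans by blast
    ultimately show ?thesis
      using x H by blast
  qed
  then obtain H y where "H face_of P" "v \<notin> H" "y \<in> H" "x \<in> closed_segment v y"
    by blast
  then show thesis
    using facet_avoiding[of P H v] assms polytope_imp_polyhedron that by blast
qed

text \<open>If the two points differed, the one nearer to \<open>v\<close> would lie strictly
  between \<open>v\<close> and the farther one, and the face through it would have to contain
  \<open>v\<close>. This controls the overlaps of pyramids with apex \<open>v\<close>.\<close>

lemma face_ray_unique:
  fixes v :: "'a::euclidean_space"
  assumes "F face_of P" "F' face_of P" "v \<in> P" "v \<notin> F" "v \<notin> F'" "y \<in> F" "y' \<in> F'"
    and "x \<in> closed_segment v y" "x \<in> closed_segment v y'" "x \<noteq> v"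
  shows "y = y'"
proof -
  \<comment> \<open>The parameter of \<open>x\<close> on its segment is larger the nearer the
    endpoint is to \<open>v\<close>. One inequality is proved for arbitrary faces and then used
    twice, with the roles exchanged.\<close>
  have le: "s \<ge> s'"
    if "F face_of P" "F' face_of P" "v \<notin> F'" "y \<in> F" "y' \<in> F'"
      and "0 < s" "s \<le> 1" "0 < s'" "s' \<le> 1" "s *\<^sub>R (y - v) = s' *\<^sub>R (y' - v)" "y' \<noteq> v" "y \<noteq> v"
    for F F' y y' s s'
  proof (rule ccontr)
    assume "\<not> s' \<le> s"
    then have s: "s < s'" by simp
    have "y' - v = (1/s') *\<^sub>R (s' *\<^sub>R (y' - v))"
      using that by simp
    also have "\<dots> = (s/s') *\<^sub>R (y - v)"
      by (simp flip: that(10))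
    finally have "y' = (1 - s/s') *\<^sub>R v + (s/s') *\<^sub>R y"
      by (simp add: algebra_simps)
    then have "y' \<in> open_segment v y"
      using that s unfolding in_segment by (auto intro!: exI[of _ "s/s'"])
    moreover have "y \<in> P"
      using that face_of_imp_subset by blast
    ultimately show False
      using that \<open>v \<in> P\<close> face_ofD by metis
  qed
  obtain s where s: "0 \<le> s" "s \<le> 1" "x = (1 - s) *\<^sub>R v + s *\<^sub>R y"
    using assms by (auto simp: in_segment)
  obtain s' where s': "0 \<le> s'" "s' \<le> 1" "x = (1 - s') *\<^sub>R v + s' *\<^sub>R y'"
    using assms by (auto simp: in_segment)
  have "s \<noteq> 0" "s' \<noteq> 0"
    using s s' \<open>x \<noteq> v\<close> by auto
  have eq: "s *\<^sub>R (y - v) = s' *\<^sub>R (y' - v)"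
    using s s' by (simp add: algebra_simps)
  have "y \<noteq> v" "y' \<noteq> v"
    using assms by auto
  then have "s = s'"
    using le[of F F' y y' s s'] le[of F' F y' y s' s] assms s s' eq \<open>s \<noteq> 0\<close> \<open>s' \<noteq> 0\<close> by auto
  with eq \<open>s \<noteq> 0\<close> show ?thesis by simp
qed

text \<open>
  The pulling triangulation: cone off from a vertex \<open>v\<close> the triangulations of the facets that avoid \<open>v\<close>.
\<close>

lemma polytope_triangulation:
  fixes P :: "'a::euclidean_space set"
  assumes "polytope P"
  obtains \<T> where "finite \<T>"
    and "\<And>C. C \<in> \<T> \<Longrightarrow> \<not> affine_dependent C"
    and "\<And>C. C \<in> \<T> \<Longrightarrow> int (card C) = aff_dim P + 1"
    and "\<And>C. C \<in> \<T> \<Longrightarrow> C \<subseteq> {v. v extreme_point_of P}"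
    and "P = (\<Union>C\<in>\<T>. convex hull C)"
    and "\<And>C C'. C \<in> \<T> \<Longrightarrow> C' \<in> \<T> \<Longrightarrow> C \<noteq> C' \<Longrightarrow>
      aff_dim (convex hull C \<inter> convex hull C') < aff_dim P"
proof -
  define tri where "tri = (\<lambda>(P :: 'a set) \<T>. finite \<T> \<and>
     (\<forall>C\<in>\<T>. \<not> affine_dependent C \<and> int (card C) = aff_dim P + 1 \<and> C \<subseteq> {v. v extreme_point_of P}) \<and>
     P = (\<Union>C\<in>\<T>. convex hull C) \<and>
     (\<forall>C\<in>\<T>. \<forall>C'\<in>\<T>. C \<noteq> C' \<longrightarrow> aff_dim (convex hull C \<inter> convex hull C') < aff_dim P))"
  have "\<exists>\<T>. tri P \<T>"
    using assms
  proof (induction "nat (aff_dim P + 1)" arbitrary: P rule: less_induct)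
    case less
    note P = \<open>polytope P\<close>
    consider "P = {}" | v where "P = {v}" | v x where "v extreme_point_of P" "x \<in> P" "x \<noteq> v"
      using extreme_point_exists_convex[of P] P polytope_imp_convex polytope_imp_compact
      by (metis all_not_in_conv is_singletonI' is_singleton_def)
    then show ?case
    proof cases
      case 1
      then have "tri P {{}}"
        by (auto simp: tri_def affine_dependent_def)
      then show ?thesis ..
    next
      case (2 v)
      then have "tri P {{v}}"
        by (auto simp: tri_def extreme_point_of_def)
      then show ?thesis ..
    next
      case (3 v x0)
      have "v \<in> P"
        using 3 by (simp add: extreme_point_of_def)
      define \<F> where "\<F> = {F. F facet_of P \<and> v \<notin> F}"
      have "finite \<F>"
        using finite_polytope_facets[OF P] by (simp add: \<F>_def)
      have face: "F face_of P" and dimF: "aff_dim F = aff_dim P - 1" and vF: "v \<notin> F"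
        and FP: "F \<subseteq> P" if "F \<in> \<F>" for F
        using that face_of_imp_subset by (auto simp: \<F>_def facet_of_def)
      have "\<exists>\<T>. tri F \<T>" if "F \<in> \<F>" for F
      proof (rule less.hyps)
        show "nat (aff_dim F + 1) < nat (aff_dim P + 1)"
          using dimF[OF that] aff_dim_geq[of F] by linarith
        show "polytope F"
          using face[OF that] P face_of_polytope_polytope by blast
      qed
      then obtain T where T: "\<And>F. F \<in> \<F> \<Longrightarrow> tri F (T F)"
        by metis
      \<comment> \<open>A face is the part of \<open>P\<close> in its own affine hull, so avoiding
        \<open>F\<close> within \<open>P\<close> means avoiding the whole affine hull. This is what
        keeps the coned simplices affinely independent.\<close>
      have v_aff: "v \<notin> affine hull F" if "F \<in> \<F>" for F
        using face_of_imp_eq_affine_Int[OF polytope_imp_convex[OF P] face[OF that]] vF[OF that]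
          \<open>v \<in> P\<close> by blast
      have TF: "\<not> affine_dependent C" "int (card C) = aff_dim P" "C \<subseteq> {v. v extreme_point_of F}"
        "convex hull C \<subseteq> F" if "F \<in> \<F>" "C \<in> T F" for F C
        using T[OF that(1)] dimF[OF that(1)] that(2) by (auto simp: tri_def)
      have v_C: "v \<notin> affine hull C" if "F \<in> \<F>" "C \<in> T F" for F C
        using v_aff[OF that(1)] TF(4)[OF that] hull_mono[of C F affine] hull_subset[of C convex]
        by blast
      define \<T> where "\<T> = (\<Union>F\<in>\<F>. insert v ` T F)"
      have seg: "convex hull (insert v C) = (\<Union>y\<in>convex hull C. closed_segment v y)"
        if "F \<in> \<F>" "C \<in> T F" for F C
      proof -
        \<comment> \<open>An empty \<open>C\<close> would force \<open>F\<close> to have dimension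
          -1, but facets are nonempty by definition.\<close>
        have "C \<noteq> {}"
          using TF(2)[OF that] dimF[OF that(1)] that(1) aff_dim_empty[of F]
          by (auto simp: \<F>_def facet_of_def)
        then show ?thesis
          by (simp add: convex_hull_insert_segments)
      qed
      have "tri P \<T>"
        unfolding tri_def
      proof (intro conjI ballI impI)
        show "finite \<T>"
          using \<open>finite \<F>\<close> T by (auto simp: \<T>_def tri_def)
      next
        fix D assume "D \<in> \<T>"
        then obtain F C where FC: "F \<in> \<F>" "C \<in> T F" "D = insert v C"
          by (auto simp: \<T>_def)
        show "\<not> affine_dependent D"
          using FC TF v_C by (simp add: affine_independent_insert)
        have "v \<notin> C" "finite C"
          using v_C[OF FC(1,2)] TF(1)[OF FC(1,2)] by (auto simp: hull_inc aff_independent_finite)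
        then show "int (card D) = aff_dim P + 1"
          using TF(2)[OF FC(1,2)] FC by simp
        show "D \<subseteq> {v. v extreme_point_of P}"
          using TF(3)[OF FC(1,2)] 3 face[OF FC(1)] FC(3) extreme_point_of_face by blast
      next
        have sub: "convex hull (insert v C) \<subseteq> P" if "F \<in> \<F>" "C \<in> T F" for F C
          using TF(4)[OF that] FP[OF that(1)] \<open>v \<in> P\<close> hull_subset[of C convex]
          by (intro hull_minimal polytope_imp_convex[OF P]) auto
        have cover: "\<exists>D\<in>\<T>. x \<in> convex hull D" if "x \<in> P" "x \<noteq> v" for x
        proof -
          obtain F y where F: "F facet_of P" "v \<notin> F" "y \<in> F" "x \<in> closed_segment v y"
            using polytope_pyramid_cover[OF P \<open>v \<in> P\<close> \<open>x \<in> P\<close> \<open>x \<noteq> v\<close>] by blast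
          then have "F \<in> \<F>" by (simp add: \<F>_def)
          then have "F = (\<Union>C\<in>T F. convex hull C)"
            using T unfolding tri_def by blast
          with F(3) obtain C where "C \<in> T F" "y \<in> convex hull C"
            by blast
          with seg[OF \<open>F \<in> \<F>\<close> \<open>C \<in> T F\<close>] F(4) \<open>F \<in> \<F>\<close> show ?thesis
            by (auto simp: \<T>_def)
        qed
        \<comment> \<open>The apex is covered as soon as there is any pyramid at all, and the second
          point \<open>x0\<close> provides one.\<close>
        moreover have "\<exists>D\<in>\<T>. v \<in> convex hull D"
          using cover[OF 3(2,3)] by (auto simp: \<T>_def hull_inc)
        ultimately show "P = (\<Union>C\<in>\<T>. convex hull C)"
          using sub by (fastforce simp: \<T>_def)
      next
        fix D D' assume "D \<in> \<T>" "D' \<in> \<T>" "D \<noteq> D'"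
        then obtain F C F' C' where FC: "F \<in> \<F>" "C \<in> T F" "D = insert v C"
          and FC': "F' \<in> \<F>" "C' \<in> T F'" "D' = insert v C'" and "C \<noteq> C'"
          by (auto simp: \<T>_def)
        define I where "I = convex hull C \<inter> convex hull C'"
        \<comment> \<open>Within one facet this is the induction hypothesis; for two different
          facets, their intersection is a proper face of at least one of them.\<close>
        have "aff_dim I < aff_dim P - 1"
        proof (cases "F = F'")
          case True
          then show ?thesis
            using T[OF FC(1)] FC(2) FC'(2) \<open>C \<noteq> C'\<close> dimF[OF FC(1)] by (auto simp: tri_def I_def)
        next
          case False
          have "F \<inter> F' \<noteq> F \<or> F \<inter> F' \<noteq> F'"
            using False by blast
          moreover have "convex F" "convex F'"
            using face FC(1) FC'(1) face_of_imp_convex by auto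
          moreover have "F \<inter> F' face_of F" "F \<inter> F' face_of F'"
            using face FC(1) FC'(1) FP by (meson face_of_Int face_of_subset inf_le1 inf_le2)+
          ultimately have "aff_dim (F \<inter> F') < aff_dim P - 1"
            using face_of_aff_dim_lt[of F "F \<inter> F'"] face_of_aff_dim_lt[of F' "F \<inter> F'"]
              dimF[OF FC(1)] dimF[OF FC'(1)] by fastforce
          moreover have "aff_dim I \<le> aff_dim (F \<inter> F')"
            using TF(4)[OF FC(1,2)] TF(4)[OF FC'(1,2)] unfolding I_def by (intro aff_dim_subset) blast
          ultimately show ?thesis by simp
        qed
        \<comment> \<open>By uniqueness along rays from \<open>v\<close>, two pyramids overlap only
          inside the cone over the overlap of their bases, and coning raises the dimension by at
          most one.\<close>
        moreover have "convex hull D \<inter> convex hull D' \<subseteq> convex hull (insert v I)"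
        proof
          fix x assume x: "x \<in> convex hull D \<inter> convex hull D'"
          show "x \<in> convex hull (insert v I)"
          proof (cases "x = v")
            case True
            then show ?thesis by (simp add: hull_inc)
          next
            case False
            obtain y y' where y: "y \<in> convex hull C" "x \<in> closed_segment v y"
              and y': "y' \<in> convex hull C'" "x \<in> closed_segment v y'"
              using x seg[OF FC(1,2)] seg[OF FC'(1,2)] FC(3) FC'(3) by auto
            have "y = y'"
              using TF(4)[OF FC(1,2)] TF(4)[OF FC'(1,2)] y y' False
                face[OF FC(1)] face[OF FC'(1)] vF[OF FC(1)] vF[OF FC'(1)] \<open>v \<in> P\<close>
              by (intro face_ray_unique[of F P F' v y y' x]) auto
            then have "closed_segment v y \<subseteq> convex hull (insert v I)"
              using y y' by (intro closed_segment_subset_convex_hull) (auto simp: I_def hull_inc)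
            with y show ?thesis by blast
          qed
        qed
        then have "aff_dim (convex hull D \<inter> convex hull D') \<le> aff_dim (insert v I)"
          by (metis aff_dim_convex_hull aff_dim_subset)
        ultimately show "aff_dim (convex hull D \<inter> convex hull D') < aff_dim P"
          by (auto simp: aff_dim_insert split: if_splits)
      qed
      then show ?thesis ..
    qed
  qed
  then obtain \<T> where "tri P \<T>" ..
  note tri = this[unfolded tri_def prod.case]
  show thesis
  proof (rule that)
    show "finite \<T>"
      by (rule tri[THEN conjunct1])
    show "P = (\<Union>C\<in>\<T>. convex hull C)"
      by (rule tri[THEN conjunct2, THEN conjunct2, THEN conjunct1])
    note simplices = tri[THEN conjunct2, THEN conjunct1, rule_format]
    show "\<not> affine_dependent C" "int (card C) = aff_dim P + 1" "C \<subseteq> {v. v extreme_point_of P}"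
      if "C \<in> \<T>" for C
      using simplices[OF that] by auto
    show "aff_dim (convex hull C \<inter> convex hull C') < aff_dim P"
      if "C \<in> \<T>" "C' \<in> \<T>" "C \<noteq> C'" for C C'
      using tri[THEN conjunct2, THEN conjunct2, THEN conjunct2, rule_format, OF that] .
  qed
qed

subsection \<open>Volumes of lattice simplices\<close>

text \<open>
  Change of variables in the library, and hence \<open>content_simplex\<close>, requires a well-ordered index type;
  this copy of an arbitrary finite type supplies one.
\<close>

typedef ('n::finite) index = "{..<CARD('n)}"
  by (rule exI[of _ 0]) simp

instance index :: (finite) finite
  by standard (simp add: type_definition.univ[OF type_definition_index])

lemma card_index: "CARD('n::finite index) = CARD('n)"
  using type_definition.card[OF type_definition_index] by simp

instantiation index :: (finite) wellorder
begin

definition less_eq_index :: "'a index \<Rightarrow> 'a index \<Rightarrow> bool" where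
  "less_eq_index x y \<longleftrightarrow> Rep_index x \<le> Rep_index y"

definition less_index :: "'a index \<Rightarrow> 'a index \<Rightarrow> bool" where
  "less_index x y \<longleftrightarrow> Rep_index x < Rep_index y"

instance
proof
  fix P :: "'a index \<Rightarrow> bool" and a
  assume step: "\<And>x. (\<And>y. y < x \<Longrightarrow> P y) \<Longrightarrow> P x"
  show "P a"
  proof (induction a rule: measure_induct_rule[of Rep_index])
    case (less a)
    show "P a"
      by (rule step, rule less) (simp add: less_index_def)
  qed
qed (auto simp: less_eq_index_def less_index_def Rep_index_inject)

end

lemma det_Ints:
  assumes "\<And>i j. A $ i $ j \<in> \<int>"
  shows "det (A :: real^'n^'n) \<in> \<int>"
  unfolding det_def using assms by (intro Ints_sum Ints_mult Ints_prod) (auto simp: sign_def)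

text \<open>Let \<open>M\<close> have the edge vectors at \<open>x0\<close> as columns. Then
  \<open>k\<close> is the absolute value of its integer determinant, and Cramer's rule supplies the
  integer coefficients. Degenerate \<open>X\<close> are included, with \<open>k = 0\<close>.\<close>

lemma lattice_simplex_content_wellorder:
  fixes X :: "(real ^ 'n :: {finite, wellorder}) set"
  assumes "finite X" "card X = Suc CARD('n)" "x0 \<in> X" "X \<subseteq> int_lattice"
  shows "\<exists>k. fact CARD('n) * measure lborel (convex hull X) = real k \<and>
    (\<forall>x\<in>int_lattice. \<exists>c. real k *\<^sub>R x = (\<Sum>v\<in>X. of_int (c v) *\<^sub>R (v - x0)))"
proof -
  have "card (UNIV :: 'n set) = card (X - {x0})"
    using assms by simp
  then obtain f where f: "bij_betw f (UNIV :: 'n set) (X - {x0})"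
    using assms(1) by (metis finite_code finite_Diff finite_same_card_bij)
  define M where "M = (\<chi> i j. f j $ i - x0 $ i)"
  have fX: "f j \<in> X" for j
    using f by (auto simp: bij_betw_def)
  have M_Ints: "M $ i $ j \<in> \<int>" for i j
  proof -
    have "f j \<in> int_lattice" "x0 \<in> int_lattice"
      using fX[of j] assms(3,4) by auto
    then show ?thesis
      by (simp add: M_def int_lattice_def)
  qed
  then obtain D where D: "det M = of_int D"
    using det_Ints by (metis Ints_cases)
  have vol: "fact CARD('n) * measure lborel (convex hull X) = \<bar>det M\<bar>"
    using content_simplex[OF assms(1-3) f] by (simp add: M_def)
  show ?thesis
  proof (intro exI[of _ "nat \<bar>D\<bar>"] conjI ballI)
    show "fact CARD('n) * measure lborel (convex hull X) = real (nat \<bar>D\<bar>)"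
      using vol D by simp
  next
    fix x :: "real ^ ('n :: _)" assume x: "x \<in> int_lattice"
    show "\<exists>c. real (nat \<bar>D\<bar>) *\<^sub>R x = (\<Sum>v\<in>X. of_int (c v) *\<^sub>R (v - x0))"
    proof (cases "D = 0")
      case True
      then show ?thesis
        by (intro exI[of _ "\<lambda>_. 0"]) simp
    next
      case False
      \<comment> \<open>Cramer's numerators: \<open>x\<close> replaces column \<open>j\<close> of
        \<open>M\<close>.\<close>
      define d where "d j = det (\<chi> i l. if l = j then x $ i else M $ i $ l)" for j
      have "d j \<in> \<int>" for j
        unfolding d_def using M_Ints x by (intro det_Ints) (auto simp: int_lattice_def)
      then have "\<forall>j. \<exists>n. d j = of_int n"
        by (auto simp: Ints_def)
      then obtain e where e: "\<And>j. d j = of_int (e j)"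
        by metis
      have "M *v (\<chi> j. d j / det M) = x"
        using cramer[of M "\<chi> j. d j / det M" x] False D by (simp add: d_def)
      then have "det M *\<^sub>R x = M *v (det M *\<^sub>R (\<chi> j. d j / det M))"
        by (simp add: matrix_vector_mult_scaleR)
      also have "det M *\<^sub>R (\<chi> j. d j / det M) = (\<chi> j. d j)"
        using False D by (simp add: vec_eq_iff)
      also have "M *v (\<chi> j. d j) = (\<Sum>j\<in>UNIV. d j *\<^sub>R (f j - x0))"
        by (simp add: matrix_vector_mult_def vec_eq_iff M_def mult.commute)
      finally have eq: "of_int D *\<^sub>R x = (\<Sum>j\<in>UNIV. of_int (e j) *\<^sub>R (f j - x0))"
        by (simp add: D e)
      \<comment> \<open>The factor \<open>sgn D\<close> turns \<open>D\<close> into its absolute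
        value. The value of \<open>c\<close> at \<open>x0\<close>, which \<open>f\<close> does not
        attain, is arbitrary but harmless because the vector \<open>x0 - x0\<close>
        vanishes.\<close>
      define c where "c v = sgn D * e (inv_into UNIV f v)" for v
      have "real (nat \<bar>D\<bar>) *\<^sub>R x = of_int (sgn D) *\<^sub>R (of_int D *\<^sub>R x)"
        by (auto simp: sgn_if)
      also have "\<dots> = (\<Sum>j\<in>UNIV. of_int (c (f j)) *\<^sub>R (f j - x0))"
        using f by (simp add: eq c_def scaleR_sum_right bij_betw_def)
      also have "\<dots> = (\<Sum>v\<in>X - {x0}. of_int (c v) *\<^sub>R (v - x0))"
        by (rule sum.reindex_bij_betw[OF f])
      also have "\<dots> = (\<Sum>v\<in>X. of_int (c v) *\<^sub>R (v - x0))"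
        using assms(1) by (intro sum.mono_neutral_left) auto
      finally show ?thesis by blast
    qed
  qed
qed

section \<open>Volume under relabelling of coordinates\<close>

lemma prod_inner_Basis_vec:
  "(\<Prod>b\<in>Basis. (x :: real^'n) \<bullet> b) = (\<Prod>i\<in>UNIV. x $ i)"
proof -
  have "(\<Prod>b\<in>Basis. x \<bullet> b) = (\<Prod>b\<in>(\<lambda>i. axis i 1) ` UNIV. x \<bullet> b)"
    by (rule prod.cong) (auto simp: Basis_vec_def)
  also have "\<dots> = (\<Prod>i\<in>UNIV. x $ i)"
    by (subst prod.reindex) (auto simp: inj_on_def axis_eq_axis cart_eq_inner_axis)
  finally show ?thesis .
qed

lemma inj_permute_coordinates:
  fixes \<pi> :: "'m::finite \<Rightarrow> 'n::finite"
  assumes "bij \<pi>"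
  shows "inj (\<lambda>x :: 'a^'n. \<chi> i. x $ \<pi> i)"
proof (rule injI)
  fix x y :: "'a^'n"
  assume "(\<chi> i. x $ \<pi> i) = (\<chi> i. y $ \<pi> i)"
  then have "x $ \<pi> i = y $ \<pi> i" for i
    by (simp add: vec_eq_iff)
  then have "x $ \<pi> (inv \<pi> j) = y $ \<pi> (inv \<pi> j)" for j
    by blast
  then show "x = y"
    using assms by (simp add: vec_eq_iff bij_is_surj surj_f_inv_f)
qed

text \<open>Two different index types are allowed, so that volumes can be moved to the well-ordered
  copy of \<open>'n\<close>. Lebesgue measure is characterized by its values on boxes, and
  relabelling only reorders the side lengths.\<close>

lemma measure_permute_coordinates:
  fixes \<pi> :: "'m::finite \<Rightarrow> 'n::finite" and S :: "(real^'n) set"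
  assumes "bij \<pi>" "compact S"
  shows "measure lborel ((\<lambda>x. \<chi> i. x $ \<pi> i) ` S :: (real^'m) set) = measure lborel S"
proof -
  define g :: "real^'n \<Rightarrow> real^'m" where "g = (\<lambda>x. \<chi> i. x $ \<pi> i)"
  have cont: "continuous_on A g" for A
    unfolding g_def by (intro continuous_intros)
  then have meas: "g \<in> borel_measurable lborel"
    using borel_measurable_continuous_onI[of g] by simp
  have [simp]: "\<pi> (inv \<pi> j) = j" "inv \<pi> (\<pi> i) = i" for i j
    using assms(1) by (auto simp: bij_is_surj surj_f_inv_f bij_is_inj)
  have "lborel = distr lborel borel g"
  proof (rule lborel_eqI)
    fix l u :: "real^'m"
    assume le: "\<And>b. b \<in> Basis \<Longrightarrow> l \<bullet> b \<le> u \<bullet> b"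
    then have le': "l $ i \<le> u $ i" for i
      by (metis axis_in_Basis_iff cart_eq_inner_axis Basis_real_def insertI1)
    define l' u' :: "real^'n" where "l' = (\<chi> j. l $ inv \<pi> j)" and "u' = (\<chi> j. u $ inv \<pi> j)"
    have "g -` box l u = box l' u'"
    proof -
      have "(\<forall>i. l $ i < x $ \<pi> i \<and> x $ \<pi> i < u $ i) \<longleftrightarrow>
        (\<forall>j. l $ inv \<pi> j < x $ j \<and> x $ j < u $ inv \<pi> j)" (is "?L \<longleftrightarrow> ?R") for x :: "real^'n"
      proof
        assume ?L
        then have "l $ inv \<pi> j < x $ \<pi> (inv \<pi> j) \<and> x $ \<pi> (inv \<pi> j) < u $ inv \<pi> j" for j
          by blast
        then show ?R by simp
      next
        assume ?R
        then have "l $ inv \<pi> (\<pi> i) < x $ \<pi> i \<and> x $ \<pi> i < u $ inv \<pi> (\<pi> i)" for i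
          by blast
        then show ?L by simp
      qed
      then show ?thesis
        by (auto simp: mem_box_cart g_def l'_def u'_def)
    qed
    then have "emeasure (distr lborel borel g) (box l u) = emeasure lborel (box l' u')"
      using meas by (subst emeasure_distr) auto
    also have "\<dots> = (\<Prod>b\<in>Basis. (u' - l') \<bullet> b)"
      using le' by (intro emeasure_lborel_box)
        (auto simp: Basis_vec_def l'_def u'_def simp flip: cart_eq_inner_axis)
    also have "(\<Prod>b\<in>Basis. (u' - l') \<bullet> b) = (\<Prod>j\<in>UNIV. (u - l) $ inv \<pi> j)"
      by (simp add: prod_inner_Basis_vec l'_def u'_def)
    also have "\<dots> = (\<Prod>b\<in>Basis. (u - l) \<bullet> b)"
      unfolding prod_inner_Basis_vec
      using assms(1) by (intro prod.reindex_bij_betw bij_imp_bij_inv)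
    finally show "emeasure (distr lborel borel g) (box l u) = (\<Prod>b\<in>Basis. (u - l) \<bullet> b)" .
  qed simp
  then have "measure lborel (g ` S) = measure (distr lborel borel g) (g ` S)"
    by simp
  also have "\<dots> = measure lborel (g -` g ` S \<inter> space lborel)"
    using meas compact_continuous_image[OF cont assms(2)]
    by (intro measure_distr) (auto intro: borel_compact)
  also have "inj g"
    unfolding g_def by (rule inj_permute_coordinates[OF assms(1)])
  then have "g -` g ` S \<inter> space lborel = S"
    by (simp add: inj_vimage_image_eq)
  finally show ?thesis by (simp add: g_def)
qed

text \<open>The relabelling \<open>g\<close> is linear and injective, preserves volume and maps
  integer points to integer points. Hence the statement for the well-ordered index type can be
  pulled back along it.\<close>

lemma lattice_simplex_content:
  fixes X :: "(real ^ 'n) set"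
  assumes "finite X" "card X = Suc CARD('n)" "x0 \<in> X" "X \<subseteq> int_lattice"
  shows "\<exists>k. fact CARD('n) * measure lborel (convex hull X) = real k \<and>
    (\<forall>x\<in>int_lattice. \<exists>c. real k *\<^sub>R x = (\<Sum>v\<in>X. of_int (c v) *\<^sub>R (v - x0)))"
proof -
  obtain \<pi> :: "'n index \<Rightarrow> 'n" where \<pi>: "bij \<pi>"
    using finite_same_card_bij[of "UNIV :: 'n index set" "UNIV :: 'n set"] by (auto simp: card_index)
  define g :: "real^'n \<Rightarrow> real^'n index" where "g = (\<lambda>x. \<chi> i. x $ \<pi> i)"
  have "linear g"
    by (rule linearI) (simp_all add: g_def vec_eq_iff)
  have "inj g"
    unfolding g_def by (rule inj_permute_coordinates[OF \<pi>])
  have g_lattice: "g x \<in> int_lattice" if "x \<in> int_lattice" for x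
    using that by (simp add: g_def int_lattice_def)
  have "card (g ` X) = Suc CARD('n index)"
    using assms(2) \<open>inj g\<close> by (simp add: card_image inj_on_subset card_index)
  then obtain k where k: "fact CARD('n index) * measure lborel (convex hull (g ` X)) = real k"
    and comb: "\<And>x. x \<in> int_lattice \<Longrightarrow>
      \<exists>c. real k *\<^sub>R x = (\<Sum>v\<in>g ` X. of_int (c v) *\<^sub>R (v - g x0))"
    using lattice_simplex_content_wellorder[of "g ` X" "g x0"] assms g_lattice by blast
  have "measure lborel (convex hull (g ` X)) = measure lborel (convex hull X)"
    using measure_permute_coordinates[OF \<pi> finite_imp_compact_convex_hull[OF assms(1)]]
    by (simp add: convex_hull_linear_image[OF \<open>linear g\<close>, symmetric]) (simp add: g_def)
  with k have "fact CARD('n) * measure lborel (convex hull X) = real k"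
    by (simp add: card_index)
  moreover have "\<exists>c. real k *\<^sub>R x = (\<Sum>v\<in>X. of_int (c v) *\<^sub>R (v - x0))" if x: "x \<in> int_lattice" for x
  proof -
    obtain c where c: "real k *\<^sub>R g x = (\<Sum>v\<in>g ` X. of_int (c v) *\<^sub>R (v - g x0))"
      using comb g_lattice x by blast
    then have "g (real k *\<^sub>R x) = g (\<Sum>v\<in>X. of_int (c (g v)) *\<^sub>R (v - x0))"
      using \<open>inj g\<close> \<open>linear g\<close>
      by (simp add: sum.reindex inj_on_subset linear_scale linear_sum linear_diff)
    then show ?thesis
      using \<open>inj g\<close> by (auto dest: injD)
  qed
  ultimately show ?thesis by blast
qed

subsection \<open>Lattice polytopes of prime volume\<close>

text \<open>A point of \<open>Q\<close> outside the closed set \<open>K\<close> is a limit of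
  interior points of \<open>Q\<close>, so \<open>interior Q - K\<close> is open and nonempty and has
  positive volume. Taking \<open>K = {}\<close> gives positivity of the volume of
  \<open>Q\<close>.\<close>

lemma content_compact_psubset:
  fixes K :: "'a::euclidean_space set"
  assumes "compact K" "compact Q" "convex Q" "interior Q \<noteq> {}" "K \<subset> Q"
  shows "measure lborel K < measure lborel Q"
proof -
  define V where "V = interior Q - K"
  obtain z where "z \<in> Q" "z \<notin> K"
    using assms(5) by blast
  have "z \<in> closure (interior Q)"
    using convex_closure_interior[OF assms(3,4)] \<open>z \<in> Q\<close> closure_subset by auto
  then have "- K \<inter> interior Q \<noteq> {}"
    using \<open>z \<notin> K\<close> assms(1) open_Int_closure_eq_empty[of "- K" "interior Q"] compact_imp_closed by blast
  then have "\<not> negligible V"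
    using assms(1) by (intro open_not_negligible) (auto simp: V_def compact_imp_closed open_Diff)
  have meas: "K \<in> lmeasurable" "Q \<in> lmeasurable" "V \<in> lmeasurable"
    using assms(1,2) by (auto simp: V_def lmeasurable_compact lmeasurable_interior
      compact_imp_bounded fmeasurable_Diff)
  with \<open>\<not> negligible V\<close> have "0 < measure lebesgue V"
    by (simp add: negligible_iff_measure less_le)
  moreover have "measure lebesgue (K \<union> V) = measure lebesgue K + measure lebesgue V"
    using meas by (intro measure_Un3[THEN trans]) (auto simp: V_def Int_Diff)
  moreover have "measure lebesgue (K \<union> V) \<le> measure lebesgue Q"
    using meas assms(5) interior_subset[of Q] by (intro measure_mono_fmeasurable) (auto simp: V_def)
  moreover have "measure lebesgue K = measure lborel K" "measure lebesgue Q = measure lborel Q"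
    using assms(1,2) by (auto intro!: measure_completion simp: borel_compact)
  ultimately show ?thesis by linarith
qed

lemma interior_full_dim_nonempty:
  fixes S :: "'a::euclidean_space set"
  assumes "convex S" "aff_dim S = int DIM('a)"
  shows "interior S \<noteq> {}"
proof -
  have "S \<noteq> {}" using assms(2) by auto
  then show ?thesis
    using assms by (simp add: interior_rel_interior_gen rel_interior_eq_empty)
qed

text \<open>Distinct simplices of the triangulation meet in convex sets of lower dimension. These
  have empty interior and are therefore negligible, so the volumes add up.\<close>

lemma full_polytope_triangulation:
  fixes P :: "'a::euclidean_space set"
  assumes "polytope P" "aff_dim P = int DIM('a)"
  obtains \<T> where "finite \<T>"
    and "\<And>C. C \<in> \<T> \<Longrightarrow> \<not> affine_dependent C"
    and "\<And>C. C \<in> \<T> \<Longrightarrow> card C = Suc DIM('a)"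
    and "\<And>C. C \<in> \<T> \<Longrightarrow> C \<subseteq> {v. v extreme_point_of P}"
    and "measure lborel P = (\<Sum>C\<in>\<T>. measure lborel (convex hull C))"
proof -
  obtain \<T> where \<T>: "finite \<T>"
    "\<And>C. C \<in> \<T> \<Longrightarrow> \<not> affine_dependent C"
    "\<And>C. C \<in> \<T> \<Longrightarrow> int (card C) = aff_dim P + 1"
    "\<And>C. C \<in> \<T> \<Longrightarrow> C \<subseteq> {v. v extreme_point_of P}"
    "P = (\<Union>C\<in>\<T>. convex hull C)"
    "\<And>C C'. C \<in> \<T> \<Longrightarrow> C' \<in> \<T> \<Longrightarrow> C \<noteq> C' \<Longrightarrow> aff_dim (convex hull C \<inter> convex hull C') < aff_dim P"
    using polytope_triangulation[OF assms(1)] by metis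
  have comp: "compact (convex hull C)" if "C \<in> \<T>" for C
    using \<T>(2)[OF that] by (simp add: aff_independent_finite finite_imp_compact_convex_hull)
  have "measure lebesgue (\<Union>C\<in>\<T>. convex hull C) = (\<Sum>C\<in>\<T>. measure lebesgue (convex hull C))"
  proof (rule measure_negligible_finite_Union_image[OF \<T>(1)])
    show "convex hull C \<in> lmeasurable" if "C \<in> \<T>" for C
      using comp[OF that] by (rule lmeasurable_compact)
    have "negligible (convex hull C \<inter> convex hull C')" if "C \<in> \<T>" "C' \<in> \<T>" "C \<noteq> C'" for C C'
    proof -
      have "interior (convex hull C \<inter> convex hull C') = {}"
        using \<T>(6)[OF that] aff_dim_nonempty_interior assms(2) by (metis less_irrefl)
      then show ?thesis
        by (simp add: negligible_convex_interior convex_Int)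
    qed
    then show "pairwise (\<lambda>C C'. negligible (convex hull C \<inter> convex hull C')) \<T>"
      by (simp add: pairwise_def)
  qed
  then have "measure lebesgue P = (\<Sum>C\<in>\<T>. measure lebesgue (convex hull C))"
    by (simp flip: \<T>(5))
  also have "\<dots> = (\<Sum>C\<in>\<T>. measure lborel (convex hull C))"
    using comp by (intro sum.cong measure_completion) (auto simp: borel_compact)
  finally have "measure lborel P = (\<Sum>C\<in>\<T>. measure lborel (convex hull C))"
    using assms(1) by (simp add: polytope_imp_compact borel_compact)
  moreover have "card C = Suc DIM('a)" if "C \<in> \<T>" for C
    using \<T>(3)[OF that] assms(2) by linarith
  ultimately show thesis
    using that[of \<T>] \<T>(1,2,4) by blast
qed

section \<open>Generated lattices and a criterion for spanning\<close>

lemma group_closure_sum: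
  assumes "\<And>i. i \<in> I \<Longrightarrow> f i \<in> group_closure S"
  shows "(\<Sum>i\<in>I. f i) \<in> group_closure S"
  using assms by (induction I rule: infinite_finite_induct) (auto intro: group_closure_add)

lemma group_closure_scaleR_int:
  fixes x :: "'a::real_vector"
  assumes "x \<in> group_closure S"
  shows "of_int c *\<^sub>R x \<in> group_closure S"
proof (induction c rule: int_induct[of _ 0])
  case base
  then show ?case by simp
next
  case (step1 i)
  then show ?case
    using assms by (simp add: scaleR_left_distrib group_closure_add)
next
  case (step2 i)
  then show ?case
    using assms by (simp add: scaleR_left_diff_distrib group_closure.diff)
qed

lemma diff_in_direction_lattice:
  assumes "v \<in> S" "w \<in> S"
  shows "v - w \<in> direction_lattice (affine_lattice S)"
proof -
  have "x \<in> affine_lattice S" if "x \<in> S" for x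
    unfolding affine_lattice_def using that
    by (intro CollectI exI[of _ "{x}"] exI[of _ "\<lambda>_. 1"]) auto
  then show ?thesis
    unfolding direction_lattice_def using assms by (intro group_closure.base) blast
qed

lemma spanningI:
  fixes P :: "(real ^ 'n) set"
  assumes "int_lattice \<subseteq> direction_lattice (affine_lattice (P \<inter> int_lattice))"
  shows "spanning P"
proof -
  have zero: "(0 :: real^'n) \<in> int_lattice"
    by (simp add: int_lattice_def)
  have diff: "x - y \<in> int_lattice" if "x \<in> int_lattice" "y \<in> int_lattice" for x y :: "real^'n"
    using that by (auto simp: int_lattice_def)
  have "{(x, y). x \<in> int_lattice \<and> y \<in> int_lattice \<and>
      x - y \<in> direction_lattice (affine_lattice (P \<inter> int_lattice))} = int_lattice \<times> int_lattice"
    using assms diff by auto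
  \<comment> \<open>All integer points are now congruent; \<open>int_lattice\<close> being nonempty
    ensures exactly one class rather than none.\<close>
  moreover have "(int_lattice :: (real^'n) set) // (int_lattice \<times> int_lattice) = {int_lattice}"
    using zero by (auto simp: quotient_def)
  ultimately show ?thesis
    by (simp add: spanning_def polytope_index_def affine_lattice_index_def)
qed

text \<open>In barycentric terms, some coordinate of a point is nonzero. For an affinely independent
  set, affine hulls of subsets intersect in the hull of the intersection, and no vertex is common to
  all the sets \<open>C - {c}\<close>. This selects the vertex to be exchanged in the main
  argument.\<close>

lemma affine_independent_avoid_facet:
  fixes C :: "'a::euclidean_space set"
  assumes "\<not> affine_dependent C" "C \<noteq> {}"
  obtains c where "c \<in> C" "x \<notin> affine hull (C - {c})"
proof -
  have "\<not> affine_dependent (\<Union>c\<in>C. C - {c})"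
    using assms(1) by (rule affine_independent_subset) blast
  then have "affine hull (\<Inter>c\<in>C. C - {c}) = (\<Inter>c\<in>C. affine hull (C - {c}))"
    using affine_hull_Inter[of "(\<lambda>c. C - {c}) ` C"] by simp
  moreover have "(\<Inter>c\<in>C. C - {c}) = {}"
    using assms(2) by blast
  ultimately show thesis
    using that by auto
qed

theorem theorem1p1:
  fixes p :: nat and P :: "(real ^ 'n) set"
  assumes "prime p"
    and "lattice_polytope P"
    and "aff_dim P = int CARD('n)"
    and "normalized_volume P = real p"
    and "\<not> empty_simplex P"
  shows "spanning P"
proof (rule ccontr)
  assume not_spanning: "\<not> spanning P"
  have P: "polytope P" and vertices: "\<And>v. v extreme_point_of P \<Longrightarrow> v \<in> P \<inter> int_lattice"
    using assms(2) by (auto simp: lattice_polytope_def extreme_point_of_def)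
  have vol: "fact CARD('n) * measure lborel P = real p"
    using assms(4) by (simp add: normalized_volume_def)
  have interior: "interior P \<noteq> {}"
    using assms(3) by (simp add: interior_full_dim_nonempty polytope_imp_convex P)
  define \<Lambda> where "\<Lambda> = direction_lattice (affine_lattice (P \<inter> int_lattice))"
  have \<Lambda>_add: "x + y \<in> \<Lambda>" if "x \<in> \<Lambda>" "y \<in> \<Lambda>" for x y
    using that by (simp add: \<Lambda>_def direction_lattice_def group_closure_add)
  have \<Lambda>_scale: "of_int c *\<^sub>R x \<in> \<Lambda>" if "x \<in> \<Lambda>" for c x
    using that by (simp add: \<Lambda>_def direction_lattice_def group_closure_scaleR_int)
  have \<Lambda>_sum: "(\<Sum>i\<in>I. f i) \<in> \<Lambda>" if "\<And>i. i \<in> I \<Longrightarrow> f i \<in> \<Lambda>" for I and f :: "'i \<Rightarrow> real^'n"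
    using that by (simp add: \<Lambda>_def direction_lattice_def group_closure_sum)

  have simplex: "\<exists>k. fact CARD('n) * measure lborel (convex hull X) = real k \<and>
      (\<forall>x\<in>int_lattice. real k *\<^sub>R x \<in> \<Lambda>)"
    if X: "finite X" "card X = Suc CARD('n)" "X \<subseteq> P \<inter> int_lattice" for X
  proof -
    obtain x0 where "x0 \<in> X"
      using X(2) by fastforce
    have "v - x0 \<in> \<Lambda>" if "v \<in> X" for v
      using that \<open>x0 \<in> X\<close> X(3) unfolding \<Lambda>_def by (intro diff_in_direction_lattice) auto
    then have "(\<Sum>v\<in>X. of_int (c v) *\<^sub>R (v - x0)) \<in> \<Lambda>" for c
      by (intro \<Lambda>_sum \<Lambda>_scale)
    then show ?thesis
      using lattice_simplex_content[OF X(1,2) \<open>x0 \<in> X\<close>] X(3) by (metis le_inf_iff)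
  qed

  obtain \<T> where \<T>: "finite \<T>" "\<And>C. C \<in> \<T> \<Longrightarrow> \<not> affine_dependent C"
    "\<And>C. C \<in> \<T> \<Longrightarrow> card C = Suc CARD('n)" "\<And>C. C \<in> \<T> \<Longrightarrow> C \<subseteq> {v. v extreme_point_of P}"
    "measure lborel P = (\<Sum>C\<in>\<T>. measure lborel (convex hull C))"
    using full_polytope_triangulation[OF P] assms(3) by auto
  have lattice_vertices: "C \<subseteq> P \<inter> int_lattice" if "C \<in> \<T>" for C
    using \<T>(4)[OF that] vertices by blast
  have "\<forall>C\<in>\<T>. \<exists>k. fact CARD('n) * measure lborel (convex hull C) = real k \<and>
      (\<forall>x\<in>int_lattice. real k *\<^sub>R x \<in> \<Lambda>)"
    using \<T>(2,3) lattice_vertices by (intro ballI simplex aff_independent_finite) auto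
  then obtain k where k: "\<And>C. C \<in> \<T> \<Longrightarrow> fact CARD('n) * measure lborel (convex hull C) = real (k C)"
    and k_\<Lambda>: "\<And>C x. C \<in> \<T> \<Longrightarrow> x \<in> int_lattice \<Longrightarrow> real (k C) *\<^sub>R x \<in> \<Lambda>"
    by metis
  have "real p = (\<Sum>C\<in>\<T>. real (k C))"
    unfolding vol[symmetric] \<T>(5) sum_distrib_left by (intro sum.cong refl k)
  then have p_sum: "p = (\<Sum>C\<in>\<T>. k C)"
    by (simp flip: of_nat_sum)
  \<comment> \<open>Adding the memberships of \<open>k C\<close> times \<open>x\<close> over the
    whole triangulation gives \<open>p\<close> times \<open>x\<close>.\<close>
  have p_\<Lambda>: "real p *\<^sub>R x \<in> \<Lambda>" if "x \<in> int_lattice" for x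
    using \<Lambda>_sum[of \<T> "\<lambda>C. real (k C) *\<^sub>R x"] k_\<Lambda> that by (simp add: p_sum scaleR_sum_left)

  \<comment> \<open>Primality and the failure of spanning are combined here: a multiplier prime to
    \<open>p\<close> would, together with \<open>p\<close> itself, put every integer vector into
    \<open>\<Lambda>\<close>.\<close>
  have p_dvd: "p dvd m" if m: "\<And>x. x \<in> int_lattice \<Longrightarrow> real m *\<^sub>R x \<in> \<Lambda>" for m
  proof (rule ccontr)
    assume "\<not> p dvd m"
    then have "coprime (int p) (int m)"
      using \<open>prime p\<close> by (simp add: prime_imp_coprime)
    then obtain a b where ab: "a * int p + b * int m = 1"
      by (metis bezout_int coprime_imp_gcd_eq_1)
    have "x \<in> \<Lambda>" if x: "x \<in> int_lattice" for x
    proof -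
      have "of_int a *\<^sub>R (real p *\<^sub>R x) + of_int b *\<^sub>R (real m *\<^sub>R x)
        = of_int (a * int p + b * int m) *\<^sub>R x"
        by (simp add: scaleR_left_distrib)
      then show ?thesis
        using \<Lambda>_add[OF \<Lambda>_scale[OF p_\<Lambda>[OF x], of a] \<Lambda>_scale[OF m[OF x], of b]] ab by simp
    qed
    then show False
      using not_spanning spanningI unfolding \<Lambda>_def by blast
  qed

  have "p > 0"
    using \<open>prime p\<close> prime_gt_0_nat by blast
  \<comment> \<open>Some summand is positive and, as a multiple of \<open>p\<close>, at least
    \<open>p\<close>; this one simplex then uses up the whole volume of \<open>P\<close>.\<close>
  then obtain C where C: "C \<in> \<T>" "k C > 0"
    unfolding p_sum by (metis gr0I sum.neutral less_irrefl)
  then have "p \<le> k C"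
    using p_dvd[OF k_\<Lambda>] by (simp add: dvd_imp_le)
  have C_indep: "\<not> affine_dependent C" and "finite C" and card_C: "card C = Suc CARD('n)"
    using \<T>(2,3)[OF C(1)] aff_independent_finite by auto
  have C_sub: "convex hull C \<subseteq> P"
    using lattice_vertices[OF C(1)] P by (intro hull_minimal) (auto simp: polytope_imp_convex)
  have P_eq: "P = convex hull C"
  proof (rule ccontr)
    assume "P \<noteq> convex hull C"
    then have "measure lborel (convex hull C) < measure lborel P"
      using content_compact_psubset[of "convex hull C" P] C_sub P interior \<open>finite C\<close>
      by (auto simp: polytope_imp_convex polytope_imp_compact finite_imp_compact_convex_hull)
    then have "real (k C) < real p"
      by (simp flip: k[OF C(1)] vol)
    with \<open>p \<le> k C\<close> show False by simp
  qed

  have "x extreme_point_of P" if x: "x \<in> P \<inter> int_lattice" for x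
  proof (rule ccontr)
    assume x_not_vertex: "\<not> x extreme_point_of P"
    have "C \<noteq> {}" using card_C by auto
    then obtain c where c: "c \<in> C" "x \<notin> affine hull (C - {c})"
      using affine_independent_avoid_facet[OF C_indep] by blast
    \<comment> \<open>Exchange \<open>c\<close> for \<open>x\<close>. Since \<open>x\<close> is off
      the hyperplane spanned by the other vertices, the new simplex is full-dimensional and has
      positive volume; losing \<open>c\<close> makes it strictly smaller than
      \<open>P\<close>.\<close>
    define X where "X = insert x (C - {c})"
    have X: "finite X" "card X = Suc CARD('n)" "X \<subseteq> P \<inter> int_lattice" "\<not> affine_dependent X"
    proof -
      show "finite X" using \<open>finite C\<close> by (simp add: X_def)
      have "x \<notin> C - {c}" using c(2) hull_inc by metis
      then show "card X = Suc CARD('n)"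
        using \<open>finite C\<close> c(1) card_C by (simp add: X_def)
      show "X \<subseteq> P \<inter> int_lattice"
        using x lattice_vertices[OF C(1)] by (auto simp: X_def)
      show "\<not> affine_dependent X"
        unfolding X_def using C_indep c(2)
        by (intro affine_independent_insert affine_independent_Diff)
    qed
    then obtain m where m: "fact CARD('n) * measure lborel (convex hull X) = real m"
      and m_\<Lambda>: "\<And>x. x \<in> int_lattice \<Longrightarrow> real m *\<^sub>R x \<in> \<Lambda>"
      using simplex by blast
    have X_sub: "convex hull X \<subseteq> P"
      using X(3) P by (intro hull_minimal) (auto simp: polytope_imp_convex)
    have "c extreme_point_of P"
      using c(1) C_indep P_eq by (simp add: extreme_point_of_convex_hull_affine_independent)
    \<comment> \<open>Lying in the smaller hull, the vertex \<open>c\<close> of \<open>P\<close>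
      would be extreme there too, hence an element of \<open>X\<close>. That leaves only
      \<open>c = x\<close>, which is not a vertex.\<close>
    then have "c \<notin> convex hull X"
      using X_sub x_not_vertex extreme_point_of_convex_hull[of c X]
      by (auto simp: X_def extreme_point_of_def)
    then have "convex hull X \<subset> P"
      using X_sub lattice_vertices[OF C(1)] c(1) by blast
    then have "measure lborel (convex hull X) < measure lborel P"
      using content_compact_psubset[of "convex hull X" P] P interior X(1)
      by (auto simp: polytope_imp_convex polytope_imp_compact finite_imp_compact_convex_hull)
    then have "real m < real p"
      by (simp flip: m vol)
    moreover have "interior (convex hull X) \<noteq> {}"
      using X(2) aff_dim_affine_independent[OF X(4)]
      by (intro interior_full_dim_nonempty) (auto simp: aff_dim_convex_hull)
    then have "{} \<subset> convex hull X"
      using interior_subset by blast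
    with \<open>interior (convex hull X) \<noteq> {}\<close> have "measure lborel (convex hull X) > 0"
      using content_compact_psubset[of "{}" "convex hull X"] X(1)
      by (auto simp: finite_imp_compact_convex_hull)
    then have "real m > 0"
      by (simp flip: m)
    ultimately show False
      using p_dvd[OF m_\<Lambda>] by (auto dest: dvd_imp_le)
  qed
  then have "P \<inter> int_lattice = {v. v extreme_point_of P}"
    using vertices by blast
  moreover have "int CARD('n) simplex P"
    using C_indep card_C P_eq by (auto simp: simplex_def)
  ultimately show False
    using assms(2,5) by (auto simp: empty_simplex_def)
qed

end
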